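(* A ternary groupoid $(A,[\,])$ is a knot-theoretic ternary group if and only if it satisfies, for all $a,b,c,d,e\in A$, the conditions $$[[abc]de]=[[adc]be],\qquad [a[bcd]e]=[a[bed]c],$$ and there exists on $A$ a unary operation $x\mapsto\bar x$ such that for all $a,b,x\in A$ $$[abb]=\bar a\qquad\text{and}\qquad [\bar a a x]=[x a\bar a]=x.$$
   Context: A ternary groupoid $(A,[\,])$ is a non-empty set $A$ with a ternary operation $[\,]\colon A^3\to A$. It is a ternary quasigroup if for all $a,b,c\in A$ each of the equations $[zab]=c$, $[azb]=c$, $[abz]=c$ has a unique solution $z\in A$. A ternary group is a ternary quasigroup that is associative: $[[abc]de]=[a[bcd]e]=[ab[cde]]$ for all $a,b,c,d,e\in A$. A knot-theoretic ternary group is a ternary group such that, for all $a,b,c,d\in A$, $[[abc]cd]=[[ab[bcd]][bcd]d]$ and $[ab[bcd]]=[a[abc][[abc]cd]]$. *)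

theory Defs
  imports Main
begin

definition ternary_groupoid :: "'a set \<Rightarrow> ('a \<Rightarrow> 'a \<Rightarrow> 'a \<Rightarrow> 'a) \<Rightarrow> bool" where
  "ternary_groupoid A f \<longleftrightarrow> A \<noteq> {} \<and> (\<forall>a\<in>A. \<forall>b\<in>A. \<forall>c\<in>A. f a b c \<in> A)"

definition ternary_quasigroup :: "'a set \<Rightarrow> ('a \<Rightarrow> 'a \<Rightarrow> 'a \<Rightarrow> 'a) \<Rightarrow> bool" where
  "ternary_quasigroup A f \<longleftrightarrow> ternary_groupoid A f \<and>
     (\<forall>a\<in>A. \<forall>b\<in>A. \<forall>c\<in>A.
        (\<exists>!z. z \<in> A \<and> f z a b = c) \<and>
        (\<exists>!z. z \<in> A \<and> f a z b = c) \<and>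
        (\<exists>!z. z \<in> A \<and> f a b z = c))"

definition ternary_group :: "'a set \<Rightarrow> ('a \<Rightarrow> 'a \<Rightarrow> 'a \<Rightarrow> 'a) \<Rightarrow> bool" where
  "ternary_group A f \<longleftrightarrow> ternary_quasigroup A f \<and>
     (\<forall>a\<in>A. \<forall>b\<in>A. \<forall>c\<in>A. \<forall>d\<in>A. \<forall>e\<in>A.
        f (f a b c) d e = f a (f b c d) e \<and>
        f a (f b c d) e = f a b (f c d e))"

definition knot_theoretic_ternary_group :: "'a set \<Rightarrow> ('a \<Rightarrow> 'a \<Rightarrow> 'a \<Rightarrow> 'a) \<Rightarrow> bool" where
  "knot_theoretic_ternary_group A f \<longleftrightarrow> ternary_group A f \<and>
     (\<forall>a\<in>A. \<forall>b\<in>A. \<forall>c\<in>A. \<forall>d\<in>A.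
        f (f a b c) c d = f (f a b (f b c d)) (f b c d) d \<and>
        f a b (f b c d) = f a (f a b c) (f (f a b c) c d))"

end

theory Submission
  imports Defs
begin

text \<open>
  In a knot-theoretic ternary group, associativity and cancellation reduce the two extra axioms to
  the single law \<open>[ccx] = [eex]\<close>: all squares act in the same way, as one involution \<open>bar\<close>.  Then
  both \<open>[[bcd][bcd]x]\<close> and \<open>[[bcd][dcb]x]\<close> equal \<open>bar x\<close>, so \<open>[bcd] = [dcb]\<close>, and the two exchange laws follow.

  Conversely, the exchange laws and the bar laws give explicit solutions of the equations in the
  first and middle argument, and the symmetry \<open>[abc] = [cba]\<close>.  Associativity follows by verifying
  that \<open>[bcd]\<close> is the solution \<open>y\<close> of \<open>[aye] = [[abc]de]\<close>.
\<close>

locale closed_ternary =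
  fixes A :: "'a set" and f :: "'a \<Rightarrow> 'a \<Rightarrow> 'a \<Rightarrow> 'a"
  assumes closed [simp, intro]: "\<lbrakk>a \<in> A; b \<in> A; c \<in> A\<rbrakk> \<Longrightarrow> f a b c \<in> A"

section \<open>From the knot laws to the exchange and bar laws\<close>

locale knot_ternary = closed_ternary +
  assumes knot: "knot_theoretic_ternary_group A f"
begin

lemma ex1_solution:
  assumes "a \<in> A" "b \<in> A" "c \<in> A"
  shows "\<exists>!z. z \<in> A \<and> f z a b = c" and "\<exists>!z. z \<in> A \<and> f a z b = c"
    and "\<exists>!z. z \<in> A \<and> f a b z = c"
  using knot assms
  unfolding knot_theoretic_ternary_group_def ternary_group_def ternary_quasigroup_def
  by simp_all

lemma solvable_left: "\<lbrakk>a \<in> A; b \<in> A; c \<in> A\<rbrakk> \<Longrightarrow> \<exists>z\<in>A. f z a b = c"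
  using ex1_solution(1)[of a b c] by blast

lemma cancel_left: "\<lbrakk>f z a b = f z' a b; z \<in> A; z' \<in> A; a \<in> A; b \<in> A\<rbrakk> \<Longrightarrow> z = z'"
  using ex1_solution(1)[of a b "f z' a b"] by auto

lemma cancel_middle: "\<lbrakk>f a z b = f a z' b; z \<in> A; z' \<in> A; a \<in> A; b \<in> A\<rbrakk> \<Longrightarrow> z = z'"
  using ex1_solution(2)[of a b "f a z' b"] by auto

lemma cancel_right: "\<lbrakk>f a b z = f a b z'; z \<in> A; z' \<in> A; a \<in> A; b \<in> A\<rbrakk> \<Longrightarrow> z = z'"
  using ex1_solution(3)[of a b "f a b z'"] by auto

lemma assoc:
  assumes "a \<in> A" "b \<in> A" "c \<in> A" "d \<in> A" "e \<in> A"
  shows "f (f a b c) d e = f a b (f c d e)" and "f a (f b c d) e = f a b (f c d e)"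
  using knot assms unfolding knot_theoretic_ternary_group_def ternary_group_def by simp_all

lemma knot_law:
  assumes "a \<in> A" "b \<in> A" "c \<in> A" "d \<in> A"
  shows "f (f a b c) c d = f (f a b (f b c d)) (f b c d) d"
  using knot assms unfolding knot_theoretic_ternary_group_def by blast

lemma square_left:
  assumes "c \<in> A" "e \<in> A" "x \<in> A"
  shows "f c c x = f e e x"
proof -
  \<comment> \<open>Solving for \<open>b\<close> makes the inner product \<open>[bcx]\<close> of the
    first knot law equal to the arbitrary element \<open>e\<close>; reassociating then leaves a
    common prefix \<open>[bb_]\<close> to cancel.\<close>
  obtain b where b: "b \<in> A" "f b c x = e"
    using solvable_left[of c x e] assms by blast
  have "f b b (f c c x) = f (f b b c) c x"
    using assms b(1) by (simp only: assoc)
  also have "\<dots> = f (f b b e) e x"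
    using knot_law[of b b c x] assms b(1) unfolding b(2) by blast
  also have "\<dots> = f b b (f e e x)"
    using assms b(1) by (simp only: assoc)
  finally have "f b b (f c c x) = f b b (f e e x)" .
  then show ?thesis
    by (rule cancel_right) (use assms b in auto)
qed

text \<open>Any square \<open>aa\<close> would act on \<open>x\<close> in the same way; using the
  square of \<open>x\<close> itself avoids choosing a base element.\<close>

definition bar :: "'a \<Rightarrow> 'a" where "bar x = f x x x"

lemma bar_closed [simp, intro]: "x \<in> A \<Longrightarrow> bar x \<in> A"
  by (simp add: bar_def)

lemma square_left_bar: "\<lbrakk>a \<in> A; x \<in> A\<rbrakk> \<Longrightarrow> f a a x = bar x"
  unfolding bar_def by (rule square_left)

lemma square_right_bar:
  assumes "a \<in> A" "b \<in> A"
  shows "f a b b = bar a"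
proof -
  \<comment> \<open>Both sides reassociate to \<open>[a[bba]a]\<close> and \<open>[a[aaa]a]\<close>,
    which agree by \<open>square_left\<close>.\<close>
  have "f (f a b b) a a = f (f a a a) a a"
    using assoc[of a b b a a, symmetric] assoc[of a a a a a, symmetric] square_left[of b a a] assms
    by simp
  then show ?thesis
    unfolding bar_def by (rule cancel_left) (use assms in auto)
qed

lemma bar_mid: "\<lbrakk>a \<in> A; x \<in> A\<rbrakk> \<Longrightarrow> f a (bar a) x = x"
proof -
  assume ax: "a \<in> A" "x \<in> A"
  have "f (bar a) (bar a) x = f a a (f a (bar a) x)"
    using ax assoc(1)[of a a a "bar a" x] by (simp add: bar_def)
  then have "bar x = bar (f a (bar a) x)"
    using ax by (simp add: square_left_bar)
  \<comment> \<open>Rewriting \<open>bar\<close> as \<open>[_aa]\<close> shows that it is injective,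
    by cancellation in the first argument.\<close>
  then have "f x a a = f (f a (bar a) x) a a"
    using ax by (simp add: square_right_bar)
  then show "f a (bar a) x = x"
    by (rule cancel_left[symmetric]) (use ax in auto)
qed

lemma bar_left: "\<lbrakk>a \<in> A; x \<in> A\<rbrakk> \<Longrightarrow> f (bar a) a x = x"
  using bar_mid[of a x] assoc[of a a a a x] by (simp add: bar_def)

lemma bar_bar: "x \<in> A \<Longrightarrow> bar (bar x) = x"
  using bar_left[of x x] square_right_bar[of "bar x" x] by simp

lemma bar_right: "\<lbrakk>a \<in> A; x \<in> A\<rbrakk> \<Longrightarrow> f x a (bar a) = x"
  using assoc(1)[of x a a a a] bar_bar[of x] by (simp add: square_right_bar)

lemma reverse:
  assumes "b \<in> A" "c \<in> A" "d \<in> A"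
  shows "f b c d = f d c b"
proof -
  \<comment> \<open>Regrouped as \<open>[[ddc]bb]\<close>, the product applies \<open>bar\<close> to
    \<open>c\<close> twice.\<close>
  have "f d (f d c b) b = f (bar c) b b"
    using assms assoc[of d d c b b] by (simp add: square_left_bar)
  then have "f d (f d c b) b = c"
    using assms by (simp add: square_right_bar bar_bar)
  then have "f (f b c d) (f d c b) b = bar b"
    using assms assoc(1)[of b c d "f d c b" b] by (simp add: square_right_bar)
  moreover have "f (f b c d) (f b c d) b = bar b"
    using assms by (simp add: square_left_bar)
  ultimately have "f (f b c d) (f b c d) b = f (f b c d) (f d c b) b"
    by simp
  then show ?thesis
    by (rule cancel_middle) (use assms in auto)
qed

text \<open>Associativity gathers the two letters to be swapped into one triple,
  \<open>[bcd]\<close> or \<open>[cde]\<close>, which \<open>reverse\<close> turns around.\<close>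

lemma exchange:
  assumes "a \<in> A" "b \<in> A" "c \<in> A" "d \<in> A" "e \<in> A"
  shows "f (f a b c) d e = f (f a d c) b e" and "f a (f b c d) e = f a (f b e d) c"
proof -
  show "f (f a b c) d e = f (f a d c) b e"
    using assms assoc[of a b c d e] assoc[of a d c b e] reverse[of b c d] by simp
  show "f a (f b c d) e = f a (f b e d) c"
    using assms assoc[of a b c d e] assoc[of a b e d c] reverse[of c d e] by simp
qed

end

section \<open>From the exchange and bar laws to the knot laws\<close>

locale exchange_ternary = closed_ternary +
  fixes bar :: "'a \<Rightarrow> 'a"
  assumes exchange_outer: "\<lbrakk>a \<in> A; b \<in> A; c \<in> A; d \<in> A; e \<in> A\<rbrakk> \<Longrightarrow>
      f (f a b c) d e = f (f a d c) b e"
    and exchange_inner: "\<lbrakk>a \<in> A; b \<in> A; c \<in> A; d \<in> A; e \<in> A\<rbrakk> \<Longrightarrow>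
      f a (f b c d) e = f a (f b e d) c"
    and bar_closed [simp, intro]: "a \<in> A \<Longrightarrow> bar a \<in> A"
    and square_right: "\<lbrakk>a \<in> A; b \<in> A\<rbrakk> \<Longrightarrow> f a b b = bar a"
    and bar_left: "\<lbrakk>a \<in> A; x \<in> A\<rbrakk> \<Longrightarrow> f (bar a) a x = x"
    and bar_right: "\<lbrakk>a \<in> A; x \<in> A\<rbrakk> \<Longrightarrow> f x a (bar a) = x"
begin

lemma bar_bar [simp]: "a \<in> A \<Longrightarrow> bar (bar a) = a"
  using bar_left[of a a] square_right[of "bar a" a] by simp

lemma bar_left': "\<lbrakk>a \<in> A; x \<in> A\<rbrakk> \<Longrightarrow> f a (bar a) x = x"
  using bar_left[of "bar a" x] by simp

lemma bar_right': "\<lbrakk>a \<in> A; x \<in> A\<rbrakk> \<Longrightarrow> f x (bar a) a = x"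
  using bar_right[of "bar a" x] by simp

text \<open>In this and the next three lemmas, an exchange brings an element next to its bar, and
  the pair cancels. They replace associativity until it is proved.\<close>

lemma contract_outer: "\<lbrakk>a \<in> A; b \<in> A; d \<in> A; e \<in> A\<rbrakk> \<Longrightarrow> f (f a b (bar d)) d e = f a b e"
  using exchange_outer[of a b "bar d" d e] by (simp add: bar_right)

lemma contract_outer': "\<lbrakk>b \<in> A; c \<in> A; d \<in> A; e \<in> A\<rbrakk> \<Longrightarrow> f (f (bar d) b c) d e = f c b e"
  using exchange_outer[of "bar d" b c d e] by (simp add: bar_left)

lemma contract_inner: "\<lbrakk>a \<in> A; b \<in> A; c \<in> A; e \<in> A\<rbrakk> \<Longrightarrow> f a (f b c (bar e)) e = f a b c"
  using exchange_inner[of a b c "bar e" e] by (simp add: bar_right)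

lemma contract_inner': "\<lbrakk>a \<in> A; c \<in> A; d \<in> A; e \<in> A\<rbrakk> \<Longrightarrow> f a (f (bar e) c d) e = f a d c"
  using exchange_inner[of a "bar e" c d e] by (simp add: bar_left)

lemma solves_left: "\<lbrakk>a \<in> A; b \<in> A; c \<in> A\<rbrakk> \<Longrightarrow> f (f c (bar b) (bar a)) a b = c"
  by (simp add: contract_outer bar_right')

text \<open>Supplies uniqueness: the formula of \<open>solves_left\<close> reconstructs any solution
  from its value.\<close>

lemma recover_left: "\<lbrakk>a \<in> A; b \<in> A; z \<in> A\<rbrakk> \<Longrightarrow> f (f z a b) (bar b) (bar a) = z"
  using exchange_outer[of z a b "bar b" "bar a"] by (simp add: bar_right bar_right')

lemma solves_middle: "\<lbrakk>a \<in> A; b \<in> A; c \<in> A\<rbrakk> \<Longrightarrow> f a (f (bar b) c (bar a)) b = c"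
  by (simp add: contract_inner' bar_left')

lemma recover_middle: "\<lbrakk>a \<in> A; b \<in> A; z \<in> A\<rbrakk> \<Longrightarrow> f (bar b) (f a z b) (bar a) = z"
  using exchange_inner[of "bar b" a z b "bar a"] by (simp add: bar_left bar_left')

lemma ex1_left: "\<lbrakk>a \<in> A; b \<in> A; c \<in> A\<rbrakk> \<Longrightarrow> \<exists>!z. z \<in> A \<and> f z a b = c"
  by (rule ex1I[of _ "f c (bar b) (bar a)"]) (auto simp: solves_left recover_left)

lemma ex1_middle: "\<lbrakk>a \<in> A; b \<in> A; c \<in> A\<rbrakk> \<Longrightarrow> \<exists>!z. z \<in> A \<and> f a z b = c"
  by (rule ex1I[of _ "f (bar b) c (bar a)"]) (auto simp: solves_middle recover_middle)

lemma ex1_right: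
  assumes "a \<in> A" "b \<in> A" "c \<in> A"
  shows "\<exists>!z. z \<in> A \<and> f a b z = c"
proof -
  \<comment> \<open>Since \<open>[abz] = [a[bz(bar a)]a]\<close>, the unknown moves to a middle
    position, where \<open>ex1_middle\<close> applies.\<close>
  have "f a b z = c \<longleftrightarrow> f b z (bar a) = f (bar a) c (bar a)" if "z \<in> A" for z
  proof
    assume "f a b z = c"
    then show "f b z (bar a) = f (bar a) c (bar a)"
      using that assms contract_inner[of a b z a] recover_middle[of a a "f b z (bar a)"] by simp
  next
    assume "f b z (bar a) = f (bar a) c (bar a)"
    then have "f a b z = f a (f (bar a) c (bar a)) a"
      using that assms contract_inner[of a b z a] by simp
    then show "f a b z = c"
      using assms by (simp add: solves_middle)
  qed
  moreover have "\<exists>!z. z \<in> A \<and> f b z (bar a) = f (bar a) c (bar a)"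
    by (rule ex1_middle) (use assms in auto)
  ultimately show ?thesis
    by metis
qed

text \<open>Appending \<open>cc\<close> to \<open>[ab(bar c)]\<close> applies \<open>bar\<close> to
  it, but also contracts it to \<open>[abc]\<close>.\<close>

lemma bar_out_right: "\<lbrakk>a \<in> A; b \<in> A; c \<in> A\<rbrakk> \<Longrightarrow> f a b (bar c) = bar (f a b c)"
  using contract_outer[of a b c c] square_right[of "f a b (bar c)" c] bar_bar[of "f a b (bar c)"]
  by simp

lemma reverse:
  assumes "a \<in> A" "b \<in> A" "c \<in> A"
  shows "f a b c = f c b a"
proof -
  \<comment> \<open>The product \<open>[[(bar y)bx]yy]\<close> evaluated by
    \<open>contract_outer'\<close> and by \<open>square_right\<close>: a reversal up to bars, which
    the next step removes.\<close>
  have *: "f x b y = bar (f (bar y) b x)" if "x \<in> A" "y \<in> A" for x y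
    using that assms contract_outer'[of b x y y] square_right[of "f (bar y) b x" y] by simp
  have "f (bar c) b a = bar (bar (f (bar a) b c))"
    using *[of "bar c" a] assms by (simp only: bar_out_right bar_closed)
  then show ?thesis
    using *[of a c] *[of c a] assms by simp
qed

lemma assoc_left:
  assumes "a \<in> A" "b \<in> A" "c \<in> A" "d \<in> A" "e \<in> A"
  shows "f (f a b c) d e = f a (f b c d) e"
proof -
  \<comment> \<open>The left side is the solution \<open>y\<close> of
    \<open>[aye] = [[abc]de]\<close> given by \<open>solves_middle\<close>. Swapping
    \<open>d\<close> with \<open>bar a\<close> lets \<open>a\<close> cancel, and then
    \<open>e\<close>.\<close>
  have "f (bar e) (f (f a b c) d e) (bar a) = f (bar e) (f (f a b c) (bar a) e) d"
    using assms by (intro exchange_inner) auto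
  also have "\<dots> = f (bar e) (f c b e) d"
    using assms exchange_outer[of a b c "bar a" e] by (simp add: bar_left')
  also have "\<dots> = f d (f e b c) (bar e)"
    using assms reverse[of c b e] reverse[of "bar e" "f e b c" d] by simp
  also have "\<dots> = f b c d"
    using assms contract_inner'[of d b c "bar e"] reverse[of d c b] by simp
  finally show ?thesis
    using assms solves_middle[of a e "f (f a b c) d e"] by simp
qed

lemma assoc_right:
  assumes "a \<in> A" "b \<in> A" "c \<in> A" "d \<in> A" "e \<in> A"
  shows "f a (f b c d) e = f a b (f c d e)"
proof -
  have "f a b (f c d e) = f c (f d e b) a"
    using assms reverse[of a b "f c d e"] assoc_left[of c d e b a] by simp
  also have "\<dots> = f a (f b e d) c"
    using assms reverse[of c "f d e b" a] reverse[of d e b] by simp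
  also have "\<dots> = f a (f b c d) e"
    using assms by (intro exchange_inner)
  finally show ?thesis ..
qed

lemma knot_law_left:
  assumes "a \<in> A" "b \<in> A" "c \<in> A" "d \<in> A"
  shows "f (f a b c) c d = f (f a b (f b c d)) (f b c d) d"
proof -
  \<comment> \<open>The value is independent of \<open>x\<close>; the two sides of the law are the
    cases \<open>x = c\<close> and \<open>x = [bcd]\<close>.\<close>
  have "f (f a b x) x d = f (bar a) b d" if "x \<in> A" for x
    using that assms exchange_outer[of a b x x d] by (simp add: square_right)
  then show ?thesis
    using assms by simp
qed

lemma knot_law_right:
  assumes "a \<in> A" "b \<in> A" "c \<in> A" "d \<in> A"
  shows "f a b (f b c d) = f a (f a b c) (f (f a b c) c d)"
proof -
  \<comment> \<open>Again independent of \<open>x\<close>, now by associativity; the cases are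
    \<open>x = b\<close> and \<open>x = [abc]\<close>.\<close>
  have "f a x (f x c d) = f (bar a) c d" if "x \<in> A" for x
    using that assms assoc_left[of a x x c d] assoc_right[of a x x c d] by (simp add: square_right)
  then show ?thesis
    using assms by simp
qed

lemma knot_theoretic: "A \<noteq> {} \<Longrightarrow> knot_theoretic_ternary_group A f"
  unfolding knot_theoretic_ternary_group_def ternary_group_def ternary_quasigroup_def
    ternary_groupoid_def
  by (intro conjI ballI)
    (assumption | rule closed ex1_left ex1_middle ex1_right assoc_left assoc_right
      knot_law_left knot_law_right)+

end

theorem theorem5p3:
  fixes A :: "'a set" and f :: "'a \<Rightarrow> 'a \<Rightarrow> 'a \<Rightarrow> 'a"
  assumes "ternary_groupoid A f"
  shows "knot_theoretic_ternary_group A f \<longleftrightarrow>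
    (\<forall>a\<in>A. \<forall>b\<in>A. \<forall>c\<in>A. \<forall>d\<in>A. \<forall>e\<in>A.
        f (f a b c) d e = f (f a d c) b e \<and>
        f a (f b c d) e = f a (f b e d) c) \<and>
    (\<exists>bar. (\<forall>a\<in>A. bar a \<in> A) \<and>
        (\<forall>a\<in>A. \<forall>b\<in>A. \<forall>x\<in>A.
           f a b b = bar a \<and>
           f (bar a) a x = x \<and>
           f x a (bar a) = x))" (is "?K \<longleftrightarrow> ?E \<and> ?B")
proof
  interpret closed_ternary A f
    using assms by unfold_locales (auto simp: ternary_groupoid_def)
  assume ?K
  then interpret knot_ternary A f
    by unfold_locales
  have ?E
    by (intro ballI conjI exchange)
  moreover have ?B
    \<comment> \<open>The witness is the cube map \<open>[xxx]\<close>.\<close>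
    by (rule exI[of _ bar]) (simp add: square_right_bar bar_left bar_right)
  ultimately show "?E \<and> ?B" ..
next
  assume EB: "?E \<and> ?B"
  then have exchange: "f (f a b c) d e = f (f a d c) b e" "f a (f b c d) e = f a (f b e d) c"
    if "a \<in> A" "b \<in> A" "c \<in> A" "d \<in> A" "e \<in> A" for a b c d e
    using that by simp_all
  obtain bar where bar_ball: "\<forall>a\<in>A. bar a \<in> A"
    "\<forall>a\<in>A. \<forall>b\<in>A. \<forall>x\<in>A. f a b b = bar a \<and> f (bar a) a x = x \<and> f x a (bar a) = x"
    using conjunct2[OF EB] by (elim exE conjE)
  note bar_closed = bar_ball(1)[rule_format] and bar = bar_ball(2)[rule_format]
  have closed: "f a b c \<in> A" if "a \<in> A" "b \<in> A" "c \<in> A" for a b c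
    using assms that by (simp add: ternary_groupoid_def)
  interpret exchange_ternary A f bar
    by unfold_locales
      (assumption | rule closed exchange bar_closed bar[THEN conjunct1]
        bar[THEN conjunct2, THEN conjunct1] bar[THEN conjunct2, THEN conjunct2])+
  show ?K
    using knot_theoretic assms by (simp add: ternary_groupoid_def)
qed

end
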